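(* Let $A$ and $B$ be AW*-algebras, with sets of normal elements $N(A)$ and $N(B)$. Suppose $f \colon N(A) \to N(B)$ is an isomorphism of piecewise algebras that restricts to an isomorphism $\mathrm{Proj}(A) \cong \mathrm{Proj}(B)$ of complete orthomodular lattices and to a group isomorphism $U(A) \cong U(B)$, and that satisfies $f(upu^* ) = f(u) f(p) f(u)^*$ for all $u \in U(A)$ and $p \in \mathrm{Proj}(A)$. Then $A \cong B$ (as AW*-algebras).
   Context: An AW*-algebra is a unital C*-algebra $A$ in which the right annihilator of every subset is of the form $pA$ for a projection (self-adjoint idempotent) $p$. $\mathrm{Proj}(A)$ is its set of projections, ordered by $p \le q \iff p = pq$; it is a complete orthomodular lattice with $p^\perp = 1-p$. $U(A)$ is the unitary group of $A$, and $N(A) = \{a \in A \mid aa^* = a^*a\}$. $N(A)$ is regarded as a piecewise algebra: two elements are commeasurable when they commute, sums and products are only considered for commuting elements, and the scalar multiplication by $\mathbb{C}$, the involution, $0$ and $1$ are total. An isomorphism of piecewise algebras $f \colon N(A) \to N(B)$ is a bijection such that $a,b$ commute if and only if $f(a), f(b)$ commute, $f(a+b) = f(a)+f(b)$ and $f(ab) = f(a)f(b)$ for commuting $a,b$, and $f(za) = zf(a)$ for $z \in \mathbb{C}$, $f(a^* ) = f(a)^*$, $f(1)=1$. An isomorphism of AW*-algebras is a $*$-isomorphism (which automatically preserves suprema of projections). *)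

theory Defs
  imports Complex_Main
begin

text \<open>
  Unital C*-algebras over the complex numbers. The underlying class is the sum of
  \<open>real_normed_algebra\<close> and \<open>monoid_mult\<close> rather than \<open>real_normed_algebra_1\<close>, since the
  latter demands \<open>0 \<noteq> 1\<close> and \<open>norm 1 = 1\<close> and so would exclude the zero algebra. For a nonzero
  algebra \<open>norm 1 = 1\<close> follows from the C*-identity.
\<close>

class cstar_algebra = real_normed_algebra + banach + monoid_mult +
  fixes scaleC :: "complex \<Rightarrow> 'a \<Rightarrow> 'a"  (infixr "*\<^sub>C" 75)
    and adj :: "'a \<Rightarrow> 'a"
  assumes scaleC_add_right: "z *\<^sub>C (a + b) = z *\<^sub>C a + z *\<^sub>C b"
    and scaleC_add_left: "(z + w) *\<^sub>C a = z *\<^sub>C a + w *\<^sub>C a"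
    and scaleC_scaleC: "z *\<^sub>C (w *\<^sub>C a) = (z * w) *\<^sub>C a"
    and scaleR_scaleC: "scaleR r a = complex_of_real r *\<^sub>C a"
    and mult_scaleC_left: "(z *\<^sub>C a) * b = z *\<^sub>C (a * b)"
    and mult_scaleC_right: "a * (z *\<^sub>C b) = z *\<^sub>C (a * b)"
    and norm_scaleC: "norm (z *\<^sub>C a) = cmod z * norm a"
    and adj_adj: "adj (adj a) = a"
    and adj_add: "adj (a + b) = adj a + adj b"
    and adj_scaleC: "adj (z *\<^sub>C a) = cnj z *\<^sub>C adj a"
    and adj_mult: "adj (a * b) = adj b * adj a"
    and cstar_identity: "norm (adj a * a) = (norm a)\<^sup>2"
begin

definition projections :: "'a set" where
  "projections = {p. adj p = p \<and> p * p = p}"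

definition unitaries :: "'a set" where
  "unitaries = {u. adj u * u = 1 \<and> u * adj u = 1}"

definition normals :: "'a set" where
  "normals = {a. a * adj a = adj a * a}"

definition right_annihilator :: "'a set \<Rightarrow> 'a set" where
  "right_annihilator S = {a. \<forall>s\<in>S. s * a = 0}"

definition proj_le :: "'a \<Rightarrow> 'a \<Rightarrow> bool" where
  "proj_le p q \<longleftrightarrow> p = p * q"

definition is_proj_sup :: "'a set \<Rightarrow> 'a \<Rightarrow> bool" where
  "is_proj_sup S s \<longleftrightarrow> s \<in> projections \<and> (\<forall>p\<in>S. proj_le p s) \<and>
     (\<forall>q\<in>projections. (\<forall>p\<in>S. proj_le p q) \<longrightarrow> proj_le s q)"

end

class aw_star_algebra = cstar_algebra +
  assumes right_annihilator_projection:
    "\<exists>p\<in>projections. right_annihilator S = {p * a | a. True}"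

text \<open>
  Sums and products of commuting normal elements are again normal (Fuglede), so the clauses
  below only use the values of \<open>f\<close> on \<open>normals\<close>.
\<close>

definition piecewise_algebra_iso :: "('a::cstar_algebra \<Rightarrow> 'b::cstar_algebra) \<Rightarrow> bool" where
  "piecewise_algebra_iso f \<longleftrightarrow>
     bij_betw f normals normals \<and>
     (\<forall>a\<in>normals. \<forall>b\<in>normals. a * b = b * a \<longleftrightarrow> f a * f b = f b * f a) \<and>
     (\<forall>a\<in>normals. \<forall>b\<in>normals. a * b = b * a \<longrightarrow> f (a + b) = f a + f b) \<and>
     (\<forall>a\<in>normals. \<forall>b\<in>normals. a * b = b * a \<longrightarrow> f (a * b) = f a * f b) \<and>
     (\<forall>z. \<forall>a\<in>normals. f (z *\<^sub>C a) = z *\<^sub>C f a) \<and>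
     (\<forall>a\<in>normals. f (adj a) = adj (f a)) \<and>
     f 1 = 1"

definition projection_lattice_iso :: "('a::cstar_algebra \<Rightarrow> 'b::cstar_algebra) \<Rightarrow> bool" where
  "projection_lattice_iso f \<longleftrightarrow>
     bij_betw f projections projections \<and>
     (\<forall>p\<in>projections. \<forall>q\<in>projections. proj_le p q \<longleftrightarrow> proj_le (f p) (f q)) \<and>
     (\<forall>p\<in>projections. f (1 - p) = 1 - f p) \<and>
     (\<forall>S\<subseteq>projections. \<forall>s. is_proj_sup S s \<longrightarrow> is_proj_sup (f ` S) (f s))"

definition unitary_group_iso :: "('a::cstar_algebra \<Rightarrow> 'b::cstar_algebra) \<Rightarrow> bool" where
  "unitary_group_iso f \<longleftrightarrow>
     bij_betw f unitaries unitaries \<and>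
     (\<forall>u\<in>unitaries. \<forall>v\<in>unitaries. f (u * v) = f u * f v)"

definition star_iso :: "('a::cstar_algebra \<Rightarrow> 'b::cstar_algebra) \<Rightarrow> bool" where
  "star_iso g \<longleftrightarrow>
     bij g \<and>
     (\<forall>a b. g (a + b) = g a + g b) \<and>
     (\<forall>z a. g (z *\<^sub>C a) = z *\<^sub>C g a) \<and>
     (\<forall>a b. g (a * b) = g a * g b) \<and>
     (\<forall>a. g (adj a) = adj (g a)) \<and>
     g 1 = 1"

end

theory Submission
  imports Defs "HOL-Analysis.Elementary_Metric_Spaces"
begin

text \<open>
  The theorem holds because the piecewise structure and the unitary group together determine the
  addition of self-adjoint elements: the additive structure is the infinitesimal part of the
  multiplication of unitaries.

  For a self-adjoint \<open>a\<close> of norm less than 1, the element \<open>u = sqrt (1 - a\<^sup>2) + \<i> a\<close> is unitary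
  and differs from \<open>1 + \<i> a\<close> by at most \<open>norm a ^ 2\<close> (lemma \<open>unitary_near_one\<close>). As \<open>sqrt (1 - a\<^sup>2)\<close>
  commutes with \<open>a\<close>, the map \<open>f\<close> respects this formula. Since \<open>a\<close> is half the difference of \<open>u\<close> and
  its adjoint, up to the factor \<open>\<i>\<close>, and \<open>f u\<close> has norm at most 1, it follows that \<open>f\<close> is
  contractive, first on self-adjoint and then on normal elements. Being a homomorphism on
  unitaries, \<open>f\<close> does not increase the distance between unitaries (\<open>norm_f_unitary_diff\<close>).

  For self-adjoint \<open>a\<close>, \<open>b\<close> and small \<open>t > 0\<close>, take the unitaries attached to \<open>t a\<close>, \<open>t b\<close> and
  \<open>t (a + b)\<close>. The product of the first two agrees with the third up to \<open>O(t\<^sup>2)\<close>. Applying \<open>f\<close>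
  gives the same for the images, so \<open>t (f (a + b) - f a - f b) = O(t\<^sup>2)\<close>, and \<open>f\<close> is additive on
  self-adjoint elements (\<open>additivity_defect_le\<close>, \<open>add_selfadjoint\<close>).

  Therefore \<open>h + \<i> k \<mapsto> f h + \<i> f k\<close>, for self-adjoint \<open>h\<close> and \<open>k\<close>, is a complex linear bijection
  extending \<open>f\<close>. It is multiplicative on unitaries, and these span the algebra
  (\<open>unitary_span_induct\<close>), so it is a *-isomorphism.
\<close>

section \<open>Elementary identities in a C*-algebra\<close>

lemma scaleC_one [simp]: "1 *\<^sub>C a = (a::'a::cstar_algebra)"
  using scaleR_scaleC[of 1 a] by simp

lemma scaleC_zero_left [simp]: "0 *\<^sub>C a = (0::'a::cstar_algebra)"
  using scaleR_scaleC[of 0 a] by simp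

lemma scaleC_zero_right [simp]: "z *\<^sub>C 0 = (0::'a::cstar_algebra)"
  using scaleC_add_right[of z "0::'a" 0] by simp

lemma scaleC_minus_right [simp]: "z *\<^sub>C (- a) = - (z *\<^sub>C (a::'a::cstar_algebra))"
  using scaleC_add_right[of z a "- a"] by (simp add: eq_neg_iff_add_eq_0 add.commute)

lemma scaleC_diff_right: "z *\<^sub>C (a - b) = z *\<^sub>C a - z *\<^sub>C (b::'a::cstar_algebra)"
  using scaleC_add_right[of z a "- b"] by simp

lemma scaleC_minus_left [simp]: "(- z) *\<^sub>C a = - (z *\<^sub>C (a::'a::cstar_algebra))"
  using scaleC_add_left[of z "- z" a] by (simp add: eq_neg_iff_add_eq_0 add.commute)

lemma scaleC_scaleR: "z *\<^sub>C (r *\<^sub>R a) = r *\<^sub>R (z *\<^sub>C (a::'a::cstar_algebra))"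
  by (simp add: scaleR_scaleC scaleC_scaleC mult.commute)

lemma scaleC_imaginary_twice [simp]: "\<i> *\<^sub>C (\<i> *\<^sub>C a) = - (a::'a::cstar_algebra)"
  by (simp add: scaleC_scaleC)

lemma scaleC_Re_Im: "z *\<^sub>C a = Re z *\<^sub>R a + \<i> *\<^sub>C (Im z *\<^sub>R (a::'a::cstar_algebra))"
proof -
  have "z *\<^sub>C a = (of_real (Re z) + \<i> * of_real (Im z)) *\<^sub>C a"
    using complex_eq[of z] by simp
  then show ?thesis
    by (simp only: scaleC_add_left scaleR_scaleC scaleC_scaleC)
qed

lemma adj_zero [simp]: "adj 0 = (0::'a::cstar_algebra)"
  using adj_add[of "0::'a" 0] by simp

lemma adj_minus [simp]: "adj (- a) = - adj (a::'a::cstar_algebra)"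
  using adj_add[of a "- a"] by (simp add: eq_neg_iff_add_eq_0 add.commute)

lemma adj_diff: "adj (a - b) = adj a - adj (b::'a::cstar_algebra)"
  using adj_add[of a "- b"] by simp

lemma adj_one [simp]: "adj 1 = (1::'a::cstar_algebra)"
  by (metis adj_adj adj_mult mult_1_left mult_1_right)

lemma adj_scaleR [simp]: "adj (r *\<^sub>R a) = r *\<^sub>R adj (a::'a::cstar_algebra)"
  by (simp add: scaleR_scaleC adj_scaleC)

lemma norm_adj [simp]: "norm (adj a) = norm (a::'a::cstar_algebra)"
proof -
  have le: "norm c \<le> norm (adj c)" for c :: 'a
  proof (cases "c = 0")
    case False
    have "norm c * norm c \<le> norm (adj c) * norm c"
      using norm_mult_ineq[of "adj c" c] by (simp add: cstar_identity power2_eq_square)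
    then show ?thesis
      using False by simp
  qed simp
  show ?thesis
    using le[of a] le[of "adj a"] by (simp add: adj_adj)
qed

lemma norm_unitary_le_1:
  fixes u :: "'a::cstar_algebra"
  assumes "u \<in> unitaries"
  shows "norm u \<le> 1"
proof -
  have "(norm (1::'a))\<^sup>2 = norm (1::'a)"
    using cstar_identity[of "1::'a"] by simp
  then have "norm (1::'a) \<le> 1"
    by (auto simp: power2_eq_square)
  moreover have "(norm u)\<^sup>2 = norm (1::'a)"
    using assms cstar_identity[of u] by (simp add: unitaries_def)
  ultimately show ?thesis
    by (metis norm_ge_zero power2_le_imp_le power_one zero_le_one)
qed

lemma selfadjoint_normal: "adj a = a \<Longrightarrow> a \<in> normals"
  by (simp add: normals_def)

lemma unitary_normal: "u \<in> unitaries \<Longrightarrow> u \<in> normals"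
  by (simp add: normals_def unitaries_def)

lemma unitary_adj: "u \<in> unitaries \<Longrightarrow> adj u \<in> unitaries"
  by (simp add: unitaries_def adj_adj)

lemma unitary_mult: "u * v \<in> unitaries" if "u \<in> unitaries" "v \<in> unitaries"
  using that unfolding unitaries_def
  by (simp add: adj_mult) (metis mult.assoc mult_1_right)

lemma minus_normal: "a \<in> normals \<Longrightarrow> - a \<in> normals"
  by (simp add: normals_def)

lemma selfadjoint_one_minus [simp]: "adj x = x \<Longrightarrow> adj (1 - x) = 1 - x"
  by (simp add: adj_diff)

definition re_part :: "'a \<Rightarrow> 'a::cstar_algebra" where
  "re_part c = (1/2) *\<^sub>R (c + adj c)"

definition im_part :: "'a \<Rightarrow> 'a::cstar_algebra" where
  "im_part c = re_part (- (\<i> *\<^sub>C c))"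

lemma adj_re_part [simp]: "adj (re_part c) = re_part c"
  by (simp add: re_part_def adj_add adj_adj add.commute)

lemma adj_im_part [simp]: "adj (im_part c) = im_part c"
  by (simp add: im_part_def)

lemma im_part_eq: "im_part c = (1/2) *\<^sub>R (\<i> *\<^sub>C (adj c - c))"
  by (simp add: im_part_def re_part_def adj_scaleC scaleC_diff_right)

lemma cartesian_decomposition: "c = re_part c + \<i> *\<^sub>C im_part c"
proof -
  have "re_part c + \<i> *\<^sub>C im_part c = (1/2) *\<^sub>R (c + adj c) + (1/2) *\<^sub>R (c - adj c)"
    by (simp add: re_part_def im_part_eq scaleC_scaleR)
  also have "\<dots> = (1/2) *\<^sub>R (c + c)"
    by (simp only: scaleR_add_right [symmetric]) simp
  finally show ?thesis
    by simp
qed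

lemma re_part_cartesian:
  assumes "adj h = h" "adj k = k"
  shows "re_part (h + \<i> *\<^sub>C k) = h" and "im_part (h + \<i> *\<^sub>C k) = k"
proof -
  have "h + \<i> *\<^sub>C k + adj (h + \<i> *\<^sub>C k) = h + h"
    using assms by (simp add: adj_add adj_scaleC)
  then show "re_part (h + \<i> *\<^sub>C k) = h"
    unfolding re_part_def by (simp only: scaleR_half_double)
  have "adj (h + \<i> *\<^sub>C k) - (h + \<i> *\<^sub>C k) = - (\<i> *\<^sub>C k + \<i> *\<^sub>C k)"
    using assms by (simp add: adj_add adj_scaleC)
  then have "\<i> *\<^sub>C (adj (h + \<i> *\<^sub>C k) - (h + \<i> *\<^sub>C k)) = k + k"
    by (simp only: scaleC_minus_right scaleC_add_right scaleC_imaginary_twice) simp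
  then show "im_part (h + \<i> *\<^sub>C k) = k"
    by (simp add: im_part_eq)
qed

section \<open>Unitaries close to the identity\<close>

text \<open>
  The element \<open>1 - x\<close> is a square root of \<open>1 - a\<^sup>2\<close> exactly when \<open>x = (a\<^sup>2 + x\<^sup>2) / 2\<close>, and on the
  ball of radius \<open>norm a ^ 2 < 1\<close> the right-hand side is a contraction. Adjointness and commutation
  with \<open>a\<close> are closed conditions preserved by the iteration, so the fixed point inherits them.
\<close>

lemma sqrt_one_minus_square:
  fixes a :: "'a::cstar_algebra"
  assumes sa: "adj a = a" and small: "norm a < 1"
  obtains x where "adj x = x" "a * x = x * a" "norm x \<le> (norm a)\<^sup>2"
    "(1 - x) * (1 - x) = 1 - a * a"
proof -
  define S where "S = {x. norm x \<le> (norm a)\<^sup>2 \<and> adj x = x \<and> a * x = x * a}"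
  define T where "T x = (1/2) *\<^sub>R (a * a + x * x)" for x
  have sq1: "(norm a)\<^sup>2 < 1"
    using small by (simp add: power_less_one_iff)
  have adj_cont: "continuous_on UNIV (adj :: 'a \<Rightarrow> 'a)"
    unfolding continuous_on_iff dist_norm by (metis adj_diff norm_adj)
  have "closed S"
    unfolding S_def
    by (intro closed_Collect_conj closed_Collect_le closed_Collect_eq adj_cont
        continuous_on_norm continuous_on_const continuous_on_id continuous_on_mult)
  then have "complete S"
    by (simp add: complete_eq_closed)
  moreover have "S \<noteq> {}"
    by (auto simp: S_def intro: exI[of _ 0])
  moreover have "T ` S \<subseteq> S"
  proof clarify
    fix x assume x: "x \<in> S"
    have "norm (a * a + x * x) \<le> norm a * norm a + norm x * norm x"
      by (intro norm_triangle_le add_mono norm_mult_ineq)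
    also have "\<dots> \<le> (norm a)\<^sup>2 + (norm a)\<^sup>2 * 1"
      using x sq1 unfolding S_def power2_eq_square[of "norm a"]
      by (intro add_mono mult_mono) auto
    finally have "norm (T x) \<le> (norm a)\<^sup>2"
      by (simp add: T_def)
    moreover have "adj (T x) = T x"
      using x sa by (simp add: T_def S_def adj_add adj_mult)
    moreover have "a * T x = T x * a"
      using x by (simp add: T_def S_def algebra_simps) (metis mult.assoc)
    ultimately show "T x \<in> S"
      by (simp add: S_def)
  qed
  moreover have "dist (T x) (T y) \<le> (norm a)\<^sup>2 * dist x y" if "x \<in> S" "y \<in> S" for x y
  proof -
    have "T x - T y = (1/2) *\<^sub>R (x * (x - y) + (x - y) * y)"
      by (simp add: T_def algebra_simps)
    also have "norm \<dots> \<le> (1/2) * (norm x * norm (x - y) + norm (x - y) * norm y)"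
      by (auto intro!: norm_triangle_le add_mono norm_mult_ineq)
    also have "\<dots> \<le> (1/2) * ((norm a)\<^sup>2 * norm (x - y) + norm (x - y) * (norm a)\<^sup>2)"
      using that by (intro mult_left_mono add_mono mult_right_mono) (auto simp: S_def)
    finally show ?thesis
      by (simp add: dist_norm mult.commute)
  qed
  ultimately have "\<exists>!x\<in>S. T x = x"
    using sq1 by (intro Banach_fix[of S "(norm a)\<^sup>2"]) auto
  then obtain x where x: "x \<in> S" "T x = x"
    by blast
  have "x + x = 2 *\<^sub>R T x"
    using x by (simp add: scaleR_2)
  then have "x + x = a * a + x * x"
    by (simp add: T_def)
  then have "(1 - x) * (1 - x) = 1 - a * a"
    by (simp add: algebra_simps)
  with x show thesis
    by (intro that[of x]) (auto simp: S_def)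
qed

lemma unitary_cartesian:
  fixes c a :: "'a::cstar_algebra"
  assumes "adj c = c" "adj a = a" "c * a = a * c" "c * c + a * a = 1"
  shows "c + \<i> *\<^sub>C a \<in> unitaries"
proof -
  have adj: "adj (c + \<i> *\<^sub>C a) = c - \<i> *\<^sub>C a"
    using assms by (simp add: adj_add adj_scaleC)
  have "(c - \<i> *\<^sub>C a) * (c + \<i> *\<^sub>C a) = c * c + a * a"
    "(c + \<i> *\<^sub>C a) * (c - \<i> *\<^sub>C a) = c * c + a * a"
    using assms(3)
    by (simp_all add: distrib_left distrib_right left_diff_distrib right_diff_distrib
        mult_scaleC_left mult_scaleC_right scaleC_add_right scaleC_diff_right)
  then show ?thesis
    using assms(4) by (simp add: unitaries_def adj)
qed

text \<open>
  This replaces the exponential of \<open>\<i> a\<close>. It is just as good to first order, but it is built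
  algebraically from commuting self-adjoint elements, so a piecewise morphism can be evaluated on it
  with no continuity known in advance.
\<close>

lemma unitary_near_one:
  fixes a :: "'a::cstar_algebra"
  assumes sa: "adj a = a" and small: "norm a < 1"
  obtains x where "adj x = x" "a * x = x * a" "norm x \<le> (norm a)\<^sup>2"
    "(1 - x) * (1 - x) = 1 - a * a" "1 - x + \<i> *\<^sub>C a \<in> unitaries"
proof -
  obtain x where x: "adj x = x" "a * x = x * a" "norm x \<le> (norm a)\<^sup>2"
    "(1 - x) * (1 - x) = 1 - a * a"
    using sqrt_one_minus_square[OF assms] by blast
  have "1 - x + \<i> *\<^sub>C a \<in> unitaries"
    by (rule unitary_cartesian) (use x sa in \<open>simp_all add: algebra_simps\<close>)
  with x show thesis
    by (rule that)
qed

text \<open>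
  A self-adjoint element of norm less than 1 is a multiple of \<open>u - adj u\<close> for the
  unitary of the previous lemma, and every element is a combination of two self-adjoint ones.
\<close>

lemma unitary_span_induct:
  fixes P :: "'a::cstar_algebra \<Rightarrow> bool"
  assumes unitary: "\<And>u. u \<in> unitaries \<Longrightarrow> P u"
    and add: "\<And>a b. P a \<Longrightarrow> P b \<Longrightarrow> P (a + b)"
    and scale: "\<And>z a. P a \<Longrightarrow> P (z *\<^sub>C a)"
  shows "P c"
proof -
  have sa: "P a" if "adj a = a" for a
  proof -
    define r where "r = norm a + 1"
    have r: "r > 0" "norm a < r"
      unfolding r_def using norm_ge_zero[of a] by linarith+
    define b where "b = (1/r) *\<^sub>R a"
    have b: "adj b = b" "norm b < 1"
      using that r by (simp_all add: b_def)
    obtain x where x: "adj x = x" "1 - x + \<i> *\<^sub>C b \<in> unitaries"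
      using unitary_near_one[OF b] by blast
    let ?u = "1 - x + \<i> *\<^sub>C b"
    have "P (?u + (-1) *\<^sub>C adj ?u)"
      using x by (intro add scale unitary unitary_adj)
    moreover have "?u + (-1) *\<^sub>C adj ?u = (2 * \<i>) *\<^sub>C b"
      using x b scaleC_add_left[of \<i> \<i> b] by (simp add: adj_add adj_scaleC)
    ultimately have "P ((of_real r / (2 * \<i>)) *\<^sub>C ((2 * \<i>) *\<^sub>C b))"
      by (metis scale)
    moreover have "(of_real r / (2 * \<i>)) *\<^sub>C ((2 * \<i>) *\<^sub>C b) = r *\<^sub>R b"
    proof -
      have "of_real r / (2 * \<i>) * (2 * \<i>) = of_real r"
        by (subst nonzero_eq_divide_eq [symmetric]) simp_all
      then show ?thesis
        by (simp only: scaleC_scaleC scaleR_scaleC)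
    qed
    moreover have "r *\<^sub>R b = a"
      using r by (simp add: b_def)
    ultimately show ?thesis
      by simp
  qed
  show ?thesis
    by (subst cartesian_decomposition[of c]) (intro add scale sa adj_re_part adj_im_part)
qed

section \<open>Linearity of a unitary-preserving piecewise isomorphism\<close>

locale piecewise_unitary_iso =
  fixes f :: "'a::cstar_algebra \<Rightarrow> 'b::cstar_algebra"
  assumes piecewise: "piecewise_algebra_iso f"
    and unitary_group: "unitary_group_iso f"
begin

lemma bij_normals: "bij_betw f normals normals"
  and add_commuting: "\<lbrakk>a \<in> normals; b \<in> normals; a * b = b * a\<rbrakk> \<Longrightarrow> f (a + b) = f a + f b"
  and mult_commuting: "\<lbrakk>a \<in> normals; b \<in> normals; a * b = b * a\<rbrakk> \<Longrightarrow> f (a * b) = f a * f b"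
  and f_scaleC: "a \<in> normals \<Longrightarrow> f (z *\<^sub>C a) = z *\<^sub>C f a"
  and f_adj: "a \<in> normals \<Longrightarrow> f (adj a) = adj (f a)"
  and f_one: "f 1 = 1"
  using piecewise by (auto simp: piecewise_algebra_iso_def)

lemma f_unitary: "u \<in> unitaries \<Longrightarrow> f u \<in> unitaries"
  and f_mult_unitary: "\<lbrakk>u \<in> unitaries; v \<in> unitaries\<rbrakk> \<Longrightarrow> f (u * v) = f u * f v"
  using unitary_group by (auto simp: unitary_group_iso_def bij_betw_def)

lemma f_scaleR: "a \<in> normals \<Longrightarrow> f (r *\<^sub>R a) = r *\<^sub>R f a"
  by (simp add: scaleR_scaleC f_scaleC)

lemma f_minus: "a \<in> normals \<Longrightarrow> f (- a) = - f a"
  using f_scaleC[of a "-1"] by simp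

lemma f_selfadjoint: "adj a = a \<Longrightarrow> adj (f a) = f a"
  using f_adj selfadjoint_normal by metis

lemma f_minus_one: "a \<in> normals \<Longrightarrow> f (a - 1) = f a - 1"
  using add_commuting[of a "- 1"] f_minus[of 1]
  by (simp add: f_one minus_normal selfadjoint_normal)

lemma f_one_minus: "a \<in> normals \<Longrightarrow> f (1 - a) = 1 - f a"
  using add_commuting[of 1 "- a"] f_minus[of a]
  by (simp add: f_one minus_normal selfadjoint_normal)

lemma f_cartesian:
  assumes "adj h = h" "adj k = k" "h * k = k * h"
  shows "f (h + \<i> *\<^sub>C k) = f h + \<i> *\<^sub>C f k"
proof -
  have "\<i> *\<^sub>C k \<in> normals"
    using assms by (simp add: normals_def adj_scaleC)
  then have "f (h + \<i> *\<^sub>C k) = f h + f (\<i> *\<^sub>C k)"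
    using assms by (intro add_commuting)
      (simp_all add: selfadjoint_normal mult_scaleC_left mult_scaleC_right)
  then show ?thesis
    using assms by (simp add: f_scaleC selfadjoint_normal)
qed

text \<open>
  The bound on \<open>f a\<close> comes from the bound on unitaries: \<open>f a\<close> is the imaginary part of the image of
  a unitary with imaginary part \<open>a\<close>.
\<close>

lemma norm_f_selfadjoint_small:
  assumes sa: "adj a = a" and small: "norm a < 1"
  shows "norm (f a) \<le> 1"
proof -
  obtain x where x: "adj x = x" "a * x = x * a" "1 - x + \<i> *\<^sub>C a \<in> unitaries"
    using unitary_near_one[OF assms] by blast
  define v where "v = f (1 - x + \<i> *\<^sub>C a)"
  have v_eq: "v = f (1 - x) + \<i> *\<^sub>C f a"
    unfolding v_def using x sa by (intro f_cartesian) (simp_all add: algebra_simps)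
  have "norm v \<le> 1"
    unfolding v_def using x by (intro norm_unitary_le_1 f_unitary)
  moreover have "v - adj v = \<i> *\<^sub>C (2 *\<^sub>R f a)"
    using x sa unfolding v_eq
    by (simp add: adj_add adj_scaleC f_selfadjoint scaleR_2 scaleC_add_right)
  then have "2 * norm (f a) = norm (v - adj v)"
    by (simp add: norm_scaleC)
  ultimately show ?thesis
    using norm_triangle_ineq4[of v "adj v"] by simp
qed

lemma norm_f_selfadjoint:
  assumes sa: "adj a = a"
  shows "norm (f a) \<le> norm a"
proof (rule dense_ge)
  fix s assume s: "norm a < s"
  then have s0: "s > 0"
    using norm_ge_zero[of a] by linarith
  have "norm (f ((1/s) *\<^sub>R a)) \<le> 1"
    using sa s s0 by (intro norm_f_selfadjoint_small) simp_all
  then show "norm (f a) \<le> s"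
    using s0 sa by (simp add: f_scaleR selfadjoint_normal)
qed

lemma norm_f_normal:
  assumes "n \<in> normals"
  shows "norm (f n) \<le> norm n"
proof -
  have n: "adj n \<in> normals" "adj n * n = n * adj n"
    using assms by (simp_all add: normals_def adj_adj)
  have "f (adj n * n) = adj (f n) * f n"
    using mult_commuting[OF n(1) assms n(2)] assms by (simp add: f_adj)
  then have "(norm (f n))\<^sup>2 = norm (f (adj n * n))"
    by (simp add: cstar_identity)
  also have "\<dots> \<le> norm (adj n * n)"
    by (rule norm_f_selfadjoint) (simp add: adj_mult adj_adj)
  finally show ?thesis
    by (simp add: cstar_identity power2_le_iff_abs_le)
qed

text \<open>
  Although \<open>u\<close> and \<open>v\<close> need not commute, the distance between them is that between \<open>u * adj v\<close>
  and 1, which do commute, so contractivity on normal elements applies.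
\<close>

lemma norm_f_unitary_diff:
  assumes "u \<in> unitaries" "v \<in> unitaries"
  shows "norm (f u - f v) \<le> norm (u - v)"
proof -
  define w where "w = u * adj v"
  have w: "w \<in> unitaries"
    unfolding w_def using assms by (intro unitary_mult unitary_adj)
  have adj_v: "adj v * v = 1" "v * adj v = 1"
    using assms by (simp_all add: unitaries_def)
  have u: "u = w * v"
    by (simp add: w_def mult.assoc adj_v)
  have n: "w - 1 \<in> normals"
    using unitary_normal[OF w] by (simp add: normals_def adj_diff algebra_simps)
  have "f u - f v = f (w - 1) * f v"
    using w assms unitary_normal[OF w] by (simp add: u f_mult_unitary f_minus_one algebra_simps)
  also have "norm \<dots> \<le> norm (f (w - 1)) * norm (f v)"
    by (rule norm_mult_ineq)
  also have "\<dots> \<le> norm (w - 1) * 1"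
    using n assms by (intro mult_mono norm_f_normal norm_unitary_le_1 f_unitary) auto
  also have "w - 1 = (u - v) * adj v"
    by (simp add: w_def algebra_simps adj_v)
  then have "norm (w - 1) * 1 \<le> norm (u - v) * norm (adj v)"
    using norm_mult_ineq[of "u - v" "adj v"] by simp
  also have "\<dots> \<le> norm (u - v) * 1"
    using norm_unitary_le_1[OF assms(2)] by (intro mult_left_mono) auto
  finally show ?thesis
    by simp
qed

lemma near_one_lift:
  assumes sa: "adj a = a" and small: "norm a < 1"
  obtains y y' where "1 + \<i> *\<^sub>C a + y \<in> unitaries"
    "f (1 + \<i> *\<^sub>C a + y) = 1 + \<i> *\<^sub>C f a + y'"
    "norm y \<le> (norm a)\<^sup>2" "norm y' \<le> (norm a)\<^sup>2"
proof -
  obtain x where x: "adj x = x" "a * x = x * a" "norm x \<le> (norm a)\<^sup>2"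
    "1 - x + \<i> *\<^sub>C a \<in> unitaries"
    using unitary_near_one[OF assms] by blast
  have eq: "1 + \<i> *\<^sub>C a + - x = 1 - x + \<i> *\<^sub>C a"
    by simp
  have "f (1 - x + \<i> *\<^sub>C a) = f (1 - x) + \<i> *\<^sub>C f a"
    using x sa by (intro f_cartesian) (simp_all add: algebra_simps)
  then have "f (1 + \<i> *\<^sub>C a + - x) = 1 + \<i> *\<^sub>C f a + - f x"
    unfolding eq using x by (simp add: f_one_minus selfadjoint_normal)
  moreover have "norm (- f x) \<le> (norm a)\<^sup>2"
    using norm_f_selfadjoint[OF x(1)] x(3) by simp
  ultimately show thesis
    using that[of "- x" "- f x"] x(3,4) unfolding eq by simp
qed

text \<open>
  The unitaries near \<open>1 + \<i> a\<close> and \<open>1 + \<i> b\<close> multiply to one near \<open>1 + \<i> (a + b)\<close>, with a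
  remainder of second order. The same computation applies on both sides of \<open>f\<close>: in the domain it
  bounds the distance of two unitaries, which \<open>f\<close> does not increase, and in the codomain it compares
  their images with \<open>1 + \<i> (f a + f b)\<close> and \<open>1 + \<i> f (a + b)\<close>. Each side contributes one summand
  to the factor 2. What matters is that the bound is quadratic while the defect is homogeneous of
  degree one.
\<close>

lemma additivity_defect_le:
  assumes sa: "adj a = a" "adj b = b"
    and small: "norm a < 1" "norm b < 1" "norm (a + b) < 1"
  shows "norm (f (a + b) - (f a + f b))
    \<le> 2 * ((norm a)\<^sup>2 + (norm b)\<^sup>2 + (norm (a + b))\<^sup>2 + 4 * (norm a * norm b))"
    (is "_ \<le> 2 * ?K")
proof -
  have sab: "adj (a + b) = a + b"
    using sa by (simp add: adj_add)
  obtain x x' where x: "1 + \<i> *\<^sub>C a + x \<in> unitaries"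
    "f (1 + \<i> *\<^sub>C a + x) = 1 + \<i> *\<^sub>C f a + x'"
    "norm x \<le> (norm a)\<^sup>2" "norm x' \<le> (norm a)\<^sup>2"
    using near_one_lift[OF sa(1) small(1)] by blast
  obtain y y' where y: "1 + \<i> *\<^sub>C b + y \<in> unitaries"
    "f (1 + \<i> *\<^sub>C b + y) = 1 + \<i> *\<^sub>C f b + y'"
    "norm y \<le> (norm b)\<^sup>2" "norm y' \<le> (norm b)\<^sup>2"
    using near_one_lift[OF sa(2) small(2)] by blast
  obtain z z' where z: "1 + \<i> *\<^sub>C (a + b) + z \<in> unitaries"
    "f (1 + \<i> *\<^sub>C (a + b) + z) = 1 + \<i> *\<^sub>C f (a + b) + z'"
    "norm z \<le> (norm (a + b))\<^sup>2" "norm z' \<le> (norm (a + b))\<^sup>2"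
    using near_one_lift[OF sab small(3)] by blast
  have linear_bound: "norm (\<i> *\<^sub>C c + w) \<le> 2 * r"
    if "norm c \<le> r" "norm w \<le> r\<^sup>2" "r < 1" for c w :: "'c::cstar_algebra" and r
  proof -
    have "r \<ge> 0"
      using that(1) norm_ge_zero[of c] by linarith
    then have "r\<^sup>2 \<le> r"
      using that(3) by (simp add: power2_eq_square mult_left_le)
    then show ?thesis
      using norm_triangle_ineq[of "\<i> *\<^sub>C c" w] that by (simp add: norm_scaleC)
  qed
  \<comment> \<open>Stated for an arbitrary algebra, since it serves both the domain and the codomain of \<open>f\<close>.\<close>
  have remainder_bound: "norm (p + q - s + (\<i> *\<^sub>C c + p) * (\<i> *\<^sub>C d + q)) \<le> ?K"
    if "norm c \<le> norm a" "norm d \<le> norm b" "norm p \<le> (norm a)\<^sup>2" "norm q \<le> (norm b)\<^sup>2"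
      "norm s \<le> (norm (a + b))\<^sup>2"
    for c d p q s :: "'c::cstar_algebra"
  proof -
    have "norm ((\<i> *\<^sub>C c + p) * (\<i> *\<^sub>C d + q)) \<le> (2 * norm a) * (2 * norm b)"
      using that small
      by (intro order_trans[OF norm_mult_ineq] mult_mono linear_bound) auto
    moreover have "norm (p + q - s) \<le> norm p + norm q + norm s"
      by (meson norm_triangle_ineq4 norm_triangle_ineq order_trans add_right_mono)
    ultimately show ?thesis
      using that norm_triangle_ineq[of "p + q - s" "(\<i> *\<^sub>C c + p) * (\<i> *\<^sub>C d + q)"] by simp
  qed
  define w where "w = (1 + \<i> *\<^sub>C a + x) * (1 + \<i> *\<^sub>C b + y)"
  define R where "R = x' + y' - z' + (\<i> *\<^sub>C f a + x') * (\<i> *\<^sub>C f b + y')"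
  have w: "w \<in> unitaries"
    unfolding w_def using x y by (intro unitary_mult)
  have "w - (1 + \<i> *\<^sub>C (a + b) + z) = x + y - z + (\<i> *\<^sub>C a + x) * (\<i> *\<^sub>C b + y)"
    by (simp add: w_def algebra_simps scaleC_add_right)
  then have "norm (w - (1 + \<i> *\<^sub>C (a + b) + z)) \<le> ?K"
    using remainder_bound[of a b x y z] x y z by (simp only: order_refl)
  then have A: "norm (f w - f (1 + \<i> *\<^sub>C (a + b) + z)) \<le> ?K"
    using norm_f_unitary_diff[OF w z(1)] by linarith
  have "f w = (1 + \<i> *\<^sub>C f a + x') * (1 + \<i> *\<^sub>C f b + y')"
    using x y by (simp add: w_def f_mult_unitary)
  then have "\<i> *\<^sub>C (f (a + b) - (f a + f b)) = R - (f w - f (1 + \<i> *\<^sub>C (a + b) + z))"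
    unfolding R_def z(2) by (simp add: algebra_simps scaleC_add_right scaleC_diff_right)
  then have "norm (f (a + b) - (f a + f b)) = norm (R - (f w - f (1 + \<i> *\<^sub>C (a + b) + z)))"
    by (metis norm_scaleC norm_ii mult_1_left)
  moreover have "norm R \<le> ?K"
    unfolding R_def using x y z norm_f_selfadjoint sa by (intro remainder_bound) auto
  then have "norm (R - (f w - f (1 + \<i> *\<^sub>C (a + b) + z))) \<le> ?K + ?K"
    by (rule order_trans[OF norm_triangle_ineq4 add_mono[OF _ A]])
  ultimately show ?thesis
    by (simp only: mult_2)
qed

lemma add_selfadjoint:
  assumes sa: "adj a = a" "adj b = b"
  shows "f (a + b) = f a + f b"
proof -
  define K where "K = (norm a)\<^sup>2 + (norm b)\<^sup>2 + (norm (a + b))\<^sup>2 + 4 * (norm a * norm b)"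
  define M where "M = norm a + norm b + 1"
  define D where "D = norm (f (a + b) - (f a + f b))"
  have M: "M > 0"
    unfolding M_def using norm_ge_zero[of a] norm_ge_zero[of b] by linarith
  have K: "K \<ge> 0"
    by (simp add: K_def)
  \<comment> \<open>The defect bound at \<open>t a\<close> and \<open>t b\<close>, divided by \<open>t\<close>; \<open>M\<close> makes all three norms less than 1.\<close>
  have bound: "D \<le> 2 * t * K" if t: "t > 0" "t < 1 / M" for t
  proof -
    have tM: "t * M < 1"
      using t M by (simp add: field_simps)
    have small: "t * n < 1" if "n \<le> M" for n
      using mult_left_mono[OF that, of t] t tM by linarith
    have n: "norm a \<le> M" "norm b \<le> M" "norm (a + b) \<le> M"
      unfolding M_def using norm_ge_zero[of a] norm_ge_zero[of b] norm_triangle_ineq[of a b]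
      by linarith+
    have scaled: "f (t *\<^sub>R a + t *\<^sub>R b) = t *\<^sub>R f (a + b)" "norm (t *\<^sub>R a + t *\<^sub>R b) = t * norm (a + b)"
      using sa t f_scaleR[of "a + b" t]
      by (simp_all add: adj_add selfadjoint_normal flip: scaleR_add_right)
    have "norm (f (t *\<^sub>R a + t *\<^sub>R b) - (f (t *\<^sub>R a) + f (t *\<^sub>R b)))
      \<le> 2 * ((norm (t *\<^sub>R a))\<^sup>2 + (norm (t *\<^sub>R b))\<^sup>2 + (norm (t *\<^sub>R a + t *\<^sub>R b))\<^sup>2
          + 4 * (norm (t *\<^sub>R a) * norm (t *\<^sub>R b)))"
      using sa t small n by (intro additivity_defect_le) (simp_all add: scaled)
    also have "\<dots> = t * (2 * t * K)"
      using t by (simp add: scaled K_def power2_eq_square algebra_simps)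
    also have "f (t *\<^sub>R a + t *\<^sub>R b) - (f (t *\<^sub>R a) + f (t *\<^sub>R b)) = t *\<^sub>R (f (a + b) - (f a + f b))"
      using sa by (simp add: scaled f_scaleR selfadjoint_normal algebra_simps)
    finally show ?thesis
      using t by (simp add: D_def)
  qed
  have "((\<lambda>t. 2 * t * K) \<longlongrightarrow> 2 * 0 * K) (at_right 0)"
    by (intro tendsto_intros)
  moreover have "\<forall>\<^sub>F t in at_right 0. D \<le> 2 * t * K"
    using eventually_at_right_real[of 0 "1 / M"] M by (auto elim!: eventually_mono intro: bound)
  ultimately have "D \<le> 2 * 0 * K"
    by (intro tendsto_lowerbound) auto
  then show ?thesis
    by (simp add: D_def)
qed

section \<open>The extension to a *-isomorphism\<close>

definition extension :: "'a \<Rightarrow> 'b" where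
  "extension c = f (re_part c) + \<i> *\<^sub>C f (im_part c)"

lemma extension_cartesian:
  "adj h = h \<Longrightarrow> adj k = k \<Longrightarrow> extension (h + \<i> *\<^sub>C k) = f h + \<i> *\<^sub>C f k"
  by (simp add: extension_def re_part_cartesian)

text \<open>The real and imaginary parts of a normal element commute.\<close>

lemma extension_normal:
  assumes "c \<in> normals"
  shows "extension c = f c"
proof -
  have "(c + adj c) * (adj c - c) = (adj c - c) * (c + adj c)"
    using assms by (simp add: normals_def algebra_simps)
  then have "re_part c * im_part c = im_part c * re_part c"
    by (simp add: re_part_def im_part_eq mult_scaleC_left mult_scaleC_right scaleC_scaleR)
  then show ?thesis
    unfolding extension_def
    by (subst (3) cartesian_decomposition[of c]) (simp add: f_cartesian)
qed

lemma extension_add: "extension (c + d) = extension c + extension d"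
proof -
  have "re_part (c + d) = re_part c + re_part d" "im_part (c + d) = im_part c + im_part d"
    by (simp_all add: re_part_def im_part_eq adj_add scaleC_add_right scaleC_diff_right algebra_simps)
  then show ?thesis
    by (simp add: extension_def add_selfadjoint scaleC_add_right)
qed

lemma extension_scaleR: "extension (r *\<^sub>R c) = r *\<^sub>R extension c"
proof -
  have "re_part (r *\<^sub>R c) = r *\<^sub>R re_part c" "im_part (r *\<^sub>R c) = r *\<^sub>R im_part c"
    by (simp_all add: re_part_def im_part_def adj_scaleC scaleC_scaleR algebra_simps)
  then show ?thesis
    by (simp add: extension_def f_scaleR selfadjoint_normal scaleC_scaleR scaleR_add_right)
qed

lemma extension_imaginary: "extension (\<i> *\<^sub>C c) = \<i> *\<^sub>C extension c"
proof -
  have "\<i> *\<^sub>C c = - im_part c + \<i> *\<^sub>C re_part c"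
    by (subst cartesian_decomposition[of c]) (simp add: scaleC_add_right)
  then have "extension (\<i> *\<^sub>C c) = f (- im_part c) + \<i> *\<^sub>C f (re_part c)"
    by (metis extension_cartesian adj_im_part adj_re_part adj_minus)
  then show ?thesis
    by (simp add: extension_def f_minus selfadjoint_normal scaleC_add_right)
qed

lemma extension_scaleC: "extension (z *\<^sub>C c) = z *\<^sub>C extension c"
  by (simp add: scaleC_Re_Im[of z] extension_add extension_imaginary extension_scaleR)

lemma extension_mult: "extension (c * d) = extension c * extension d"
proof (induction c rule: unitary_span_induct)
  case (1 u)
  show ?case
  proof (induction d rule: unitary_span_induct)
    case (1 v)
    then show ?case
      using \<open>u \<in> unitaries\<close>
      by (simp add: extension_normal unitary_normal unitary_mult f_mult_unitary)
  qed (simp_all add: distrib_left extension_add mult_scaleC_right extension_scaleC)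
qed (simp_all add: distrib_right extension_add mult_scaleC_left extension_scaleC)

lemma extension_adj: "extension (adj c) = adj (extension c)"
proof -
  have "adj c = re_part c + \<i> *\<^sub>C (- im_part c)"
    by (subst cartesian_decomposition[of c]) (simp add: adj_add adj_scaleC)
  then have "extension (adj c) = f (re_part c) + \<i> *\<^sub>C f (- im_part c)"
    by (metis extension_cartesian adj_im_part adj_re_part adj_minus)
  then show ?thesis
    by (simp add: extension_def f_minus selfadjoint_normal adj_add adj_scaleC f_selfadjoint)
qed

lemma bij_extension: "bij extension"
proof (rule bijI)
  have inj: "inj_on f normals"
    using bij_normals by (rule bij_betw_imp_inj_on)
  show "inj extension"
  proof (rule injI)
    fix c d assume eq: "extension c = extension d"
    have parts: "re_part (extension e) = f (re_part e)" "im_part (extension e) = f (im_part e)" for e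
      by (simp_all add: extension_def re_part_cartesian f_selfadjoint)
    have "f (re_part c) = f (re_part d)" "f (im_part c) = f (im_part d)"
      by (simp_all only: eq flip: parts)
    then have "re_part c = re_part d" "im_part c = im_part d"
      by (simp_all add: inj_on_eq_iff[OF inj] selfadjoint_normal)
    then show "c = d"
      by (subst (1 2) cartesian_decomposition) simp
  qed
  have selfadjoint_preimage: "\<exists>h. adj h = h \<and> f h = h'" if h': "adj h' = h'" for h'
  proof -
    have "h' \<in> f ` normals"
      using selfadjoint_normal[OF h'] bij_betw_imp_surj_on[OF bij_normals] by simp
    then obtain h where h: "h \<in> normals" "f h = h'"
      by blast
    have "adj h \<in> normals"
      using h by (simp add: normals_def adj_adj)
    moreover have "f (adj h) = f h"
      using h h' by (simp add: f_adj)
    ultimately show ?thesis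
      using inj_onD[OF inj, of "adj h" h] h by auto
  qed
  show "surj extension"
  proof (simp only: surj_def, rule allI)
    fix d
    obtain h k where "adj h = h" "f h = re_part d" "adj k = k" "f k = im_part d"
      using selfadjoint_preimage adj_re_part adj_im_part by metis
    then have "extension (h + \<i> *\<^sub>C k) = d"
      using cartesian_decomposition[of d] by (simp add: extension_cartesian)
    then show "\<exists>c. d = extension c"
      by blast
  qed
qed

lemma star_iso_extension: "star_iso extension"
  unfolding star_iso_def
  using bij_extension extension_add extension_scaleC extension_mult extension_adj
    extension_normal[of 1] f_one by (simp add: selfadjoint_normal)

end

theorem mainTheorem1:
  fixes f :: "'a::aw_star_algebra \<Rightarrow> 'b::aw_star_algebra"
  assumes "piecewise_algebra_iso f"
    and "projection_lattice_iso f"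
    and "unitary_group_iso f"
    and "\<And>u p. u \<in> unitaries \<Longrightarrow> p \<in> projections \<Longrightarrow> f (u * p * adj u) = f u * f p * adj (f u)"
  shows "\<exists>g :: 'a \<Rightarrow> 'b. star_iso g"
proof -
  interpret piecewise_unitary_iso f
    using assms by unfold_locales
  show ?thesis
    using star_iso_extension by blast
qed

end
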